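(* Let $\mathbb{K}$ be an algebraically closed field of characteristic zero, $A=\mathbb{K}[x_1,\dots,x_n]$, $W_n(\mathbb{K})=\mathrm{Der}_{\mathbb{K}}(A)$, and let $D=x_1\partial_2+x_2\partial_3+\dots+x_{n-1}\partial_n$ be the basic Weitzenböck derivation on $A$. Let $a_1,\dots,a_k$ be a (finite) system of generators of the kernel $A_1=\mathrm{Ker}\,D$ as a subalgebra of $A$. Let $$S_n=\Bigl\{\widehat{D}^{k_1}(a_{i_1})\cdots\widehat{D}^{k_t}(a_{i_t})\ \Big|\ t\ge 1,\ a_{i_1},\dots,a_{i_t}\in\{a_1,\dots,a_k\},\ k_1,\dots,k_t\ge 0,\ \sum_{j=1}^t k_j\le n-1\Bigr\},$$ where, by convention, in the definition of $S_n$ one reads $\widehat{D}^0(a_j)=1$ for all $j$. Then the centralizer $C_{W_n(\mathbb{K})}(D)$ is generated, as a module over $\mathrm{Ker}\,D$, by $\{D_s : s\in S_n\}$, where $$D_s=\sum_{i=1}^n D^{n-i}(s)\,\frac{\partial}{\partial x_i}.$$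
   Context: $\partial_i=\partial/\partial x_i$. The linear derivation $\widehat D$ of $A$ is defined by $\widehat D(x_i)=i(n-i)x_{i+1}$ for $i=1,\dots,n$ (so $\widehat D(x_n)=0$). $C_{W_n(\mathbb{K})}(D)=\{T\in W_n(\mathbb{K}) : [T,D]=0\}$, which is a module over the ring $\mathrm{Ker}\,D=\{f\in A: D(f)=0\}$. $D^0(s)=s$. *)

theory Defs
  imports
    "HOL-Library.Poly_Mapping"
    "HOL-Computational_Algebra.Polynomial"
begin

text \<open>
  Polynomials over \<open>'k\<close> in the variables indexed by a finite type \<open>'v\<close>: finitely supported maps
  from exponent vectors to coefficients, with the convolution product of
  \<^theory>\<open>HOL-Library.Poly_Mapping\<close>.  An ordering \<open>x\<^sub>1, \<dots>, x\<^sub>n\<close> of the variables is a bijection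
  \<open>x\<close> from \<open>{1..n}\<close> onto \<open>'v\<close>, so that \<open>('k, 'v) mpoly\<close> is \<open>K[x\<^sub>1, \<dots>, x\<^sub>n]\<close>.
\<close>

type_synonym ('k, 'v) mpoly = "('v \<Rightarrow>\<^sub>0 nat) \<Rightarrow>\<^sub>0 'k"

definition Const :: "'k::comm_ring_1 \<Rightarrow> ('k, 'v::finite) mpoly" where
  "Const c = Poly_Mapping.single 0 c"

definition Var :: "'v::finite \<Rightarrow> ('k::comm_ring_1, 'v) mpoly" where
  "Var v = Poly_Mapping.single (Poly_Mapping.single v 1) 1"

text \<open>
  The truncated subtraction in the exponent is harmless: if \<open>v\<close> does not occur in the monomial
  \<open>m\<close>, the coefficient vanishes.
\<close>

definition partial :: "'v::finite \<Rightarrow> ('k::comm_ring_1, 'v) mpoly \<Rightarrow> ('k, 'v) mpoly" where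
  "partial v f = (\<Sum>m\<in>Poly_Mapping.keys f.
     Poly_Mapping.single (m - Poly_Mapping.single v 1)
       (of_nat (Poly_Mapping.lookup m v) * Poly_Mapping.lookup f m))"

definition is_derivation ::
  "(('k::comm_ring_1, 'v::finite) mpoly \<Rightarrow> ('k, 'v) mpoly) \<Rightarrow> bool" where
  "is_derivation T \<longleftrightarrow>
     (\<forall>f g. T (f + g) = T f + T g) \<and>
     (\<forall>c f. T (Const c * f) = Const c * T f) \<and>
     (\<forall>f g. T (f * g) = T f * g + f * T g)"

definition W :: "(('k::comm_ring_1, 'v::finite) mpoly \<Rightarrow> ('k, 'v) mpoly) set" where
  "W = {T. is_derivation T}"

definition lie_bracket ::
  "(('k::comm_ring_1, 'v::finite) mpoly \<Rightarrow> ('k, 'v) mpoly) \<Rightarrow>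
   (('k, 'v) mpoly \<Rightarrow> ('k, 'v) mpoly) \<Rightarrow> ('k, 'v) mpoly \<Rightarrow> ('k, 'v) mpoly" where
  "lie_bracket T U = (\<lambda>f. T (U f) - U (T f))"

definition centralizer ::
  "(('k::comm_ring_1, 'v::finite) mpoly \<Rightarrow> ('k, 'v) mpoly) \<Rightarrow>
   (('k, 'v) mpoly \<Rightarrow> ('k, 'v) mpoly) set" where
  "centralizer D = {T \<in> W. lie_bracket T D = (\<lambda>f. 0)}"

definition Ker ::
  "(('k::comm_ring_1, 'v::finite) mpoly \<Rightarrow> ('k, 'v) mpoly) \<Rightarrow> ('k, 'v) mpoly set" where
  "Ker D = {f. D f = 0}"

definition is_subalgebra :: "('k::comm_ring_1, 'v::finite) mpoly set \<Rightarrow> bool" where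
  "is_subalgebra B \<longleftrightarrow>
     1 \<in> B \<and>
     (\<forall>f\<in>B. \<forall>g\<in>B. f + g \<in> B) \<and>
     (\<forall>c. \<forall>f\<in>B. Const c * f \<in> B) \<and>
     (\<forall>f\<in>B. \<forall>g\<in>B. f * g \<in> B)"

definition generated_subalgebra ::
  "('k::comm_ring_1, 'v::finite) mpoly set \<Rightarrow> ('k, 'v) mpoly set" where
  "generated_subalgebra G = is_subalgebra hull G"

text \<open>
  Closure under additive inverses is implied whenever \<open>-1 \<in> R\<close>, in particular if \<open>R\<close> is a subring.
\<close>

definition is_submodule ::
  "('k::comm_ring_1, 'v::finite) mpoly set \<Rightarrow>
   (('k, 'v) mpoly \<Rightarrow> ('k, 'v) mpoly) set \<Rightarrow> bool" where
  "is_submodule R N \<longleftrightarrow>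
     (\<lambda>f. 0) \<in> N \<and>
     (\<forall>T\<in>N. \<forall>U\<in>N. (\<lambda>f. T f + U f) \<in> N) \<and>
     (\<forall>r\<in>R. \<forall>T\<in>N. (\<lambda>f. r * T f) \<in> N)"

definition generated_submodule ::
  "('k::comm_ring_1, 'v::finite) mpoly set \<Rightarrow>
   (('k, 'v) mpoly \<Rightarrow> ('k, 'v) mpoly) set \<Rightarrow>
   (('k, 'v) mpoly \<Rightarrow> ('k, 'v) mpoly) set" where
  "generated_submodule R G = is_submodule R hull G"

definition weitzenboeck ::
  "nat \<Rightarrow> (nat \<Rightarrow> 'v::finite) \<Rightarrow> ('k::comm_ring_1, 'v) mpoly \<Rightarrow> ('k, 'v) mpoly" where
  "weitzenboeck n x f = (\<Sum>i\<in>{1..<n}. Var (x i) * partial (x (i + 1)) f)"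

text \<open>
  The derivation with \<open>x\<^sub>i \<mapsto> i (n - i) x\<^sub>i\<^sub>+\<^sub>1\<close>; see \<open>dual_weitzenboeck_Var\<close> below.  The index \<open>i = n\<close>
  is omitted since its coefficient is zero and \<open>x\<^sub>n\<^sub>+\<^sub>1\<close> does not exist.
\<close>

definition dual_weitzenboeck ::
  "nat \<Rightarrow> (nat \<Rightarrow> 'v::finite) \<Rightarrow> ('k::comm_ring_1, 'v) mpoly \<Rightarrow> ('k, 'v) mpoly" where
  "dual_weitzenboeck n x f =
     (\<Sum>i\<in>{1..<n}. of_nat (i * (n - i)) * Var (x (i + 1)) * partial (x i) f)"

text \<open>
  Powers of the dual derivation, with the zeroth power read as the constant \<open>1\<close> and not as the
  identity map.  This convention concerns the set \<open>S_set\<close> only.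
\<close>

definition dual_power ::
  "nat \<Rightarrow> (nat \<Rightarrow> 'v::finite) \<Rightarrow> nat \<Rightarrow> ('k::comm_ring_1, 'v) mpoly \<Rightarrow> ('k, 'v) mpoly" where
  "dual_power n x k f = (if k = 0 then 1 else (dual_weitzenboeck n x ^^ k) f)"

definition S_set ::
  "nat \<Rightarrow> (nat \<Rightarrow> 'v::finite) \<Rightarrow> nat \<Rightarrow> (nat \<Rightarrow> ('k::comm_ring_1, 'v) mpoly) \<Rightarrow>
   ('k, 'v) mpoly set" where
  "S_set n x r a =
     {(\<Prod>j\<in>{1..t}. dual_power n x (k j) (a (i j))) | (t::nat) i k.
        t \<ge> 1 \<and> (\<forall>j\<in>{1..t}. i j \<in> {1..r}) \<and> (\<Sum>j\<in>{1..t}. k j) \<le> n - 1}"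

definition D_sub ::
  "nat \<Rightarrow> (nat \<Rightarrow> 'v::finite) \<Rightarrow> ('k::comm_ring_1, 'v) mpoly \<Rightarrow>
   ('k, 'v) mpoly \<Rightarrow> ('k, 'v) mpoly" where
  "D_sub n x s f = (\<Sum>i\<in>{1..n}. (weitzenboeck n x ^^ (n - i)) s * partial (x i) f)"

lemma partial_Var: "partial v (Var w) = (if v = w then 1 else 0)"
  by (auto simp: partial_def Var_def lookup_single when_def)

lemma partial_add: "partial v (f + g) = partial v f + partial v g"
  unfolding partial_def
  by (rule setsum_keys_plus_distrib) (simp_all add: single_add[symmetric] algebra_simps)

lemma partial_single:
  "partial v (Poly_Mapping.single m c) =
     Poly_Mapping.single (m - Poly_Mapping.single v 1) (of_nat (Poly_Mapping.lookup m v) * c)"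
  by (simp add: partial_def)

lemma mpoly_induct [case_names zero single add]:
  fixes f :: "('k::comm_ring_1, 'v::finite) mpoly"
  assumes "P 0" "\<And>m c. P (Poly_Mapping.single m c)" "\<And>f g. P f \<Longrightarrow> P g \<Longrightarrow> P (f + g)"
  shows "P f"
proof -
  have sum: "P (\<Sum>m\<in>M. Poly_Mapping.single m (Poly_Mapping.lookup f m))" if "finite M" for M
    using that by (induction M rule: finite_induct) (auto intro: assms)
  have "f = (\<Sum>m\<in>Poly_Mapping.keys f. Poly_Mapping.single m (Poly_Mapping.lookup f m))"
    by (rule poly_mapping_eqI)
       (auto simp: lookup_sum lookup_single when_def in_keys_iff sum.delta)
  with sum[of "Poly_Mapping.keys f"] show ?thesis by simp
qed

lemma partial_mult: "partial v (f * g) = partial v f * g + f * partial v g"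
proof (induction f rule: mpoly_induct)
  case zero
  then show ?case by (simp add: partial_def)
next
  case (single m c)
  show ?case
  proof (induction g rule: mpoly_induct)
    case zero
    then show ?case by (simp add: partial_def)
  next
    case (single l d)
    let ?e = "Poly_Mapping.single v (1::nat)"
    have shift: "m' - ?e + l' = m' + l' - ?e" if "Poly_Mapping.lookup m' v \<noteq> 0" for m' l'
      by (rule poly_mapping_eqI) (use that in \<open>auto simp: lookup_add lookup_minus lookup_single when_def\<close>)
    have 1: "Poly_Mapping.single (m - ?e + l) (of_nat (Poly_Mapping.lookup m v) * c * d) =
          Poly_Mapping.single (m + l - ?e) (of_nat (Poly_Mapping.lookup m v) * c * d)"
      using shift[of m l] by (cases "Poly_Mapping.lookup m v = 0") simp_all
    have 2: "Poly_Mapping.single (m + (l - ?e)) (c * (of_nat (Poly_Mapping.lookup l v) * d)) =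
          Poly_Mapping.single (m + l - ?e) (c * (of_nat (Poly_Mapping.lookup l v) * d))"
      using shift[of l m] by (cases "Poly_Mapping.lookup l v = 0") (simp_all add: add.commute)
    show ?case
      unfolding mult_single partial_single 1 2
      by (simp add: single_add[symmetric] lookup_add algebra_simps)
  next
    case (add f g)
    then show ?case by (simp add: partial_add distrib_left algebra_simps)
  qed
next
  case (add f h)
  then show ?case by (simp add: partial_add distrib_right algebra_simps)
qed

lemma partial_Const: "partial v (Const c) = 0"
  by (simp add: Const_def partial_single)

lemma is_derivation_vector_field:
  "is_derivation (\<lambda>f. \<Sum>i\<in>I. p i * partial (q i) f)"
  by (auto simp: is_derivation_def partial_add partial_mult partial_Const distrib_left sum.distrib
      sum_distrib_left sum_distrib_right ac_simps)

lemma is_derivation_weitzenboeck: "is_derivation (weitzenboeck n x)"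
  unfolding weitzenboeck_def[abs_def] by (rule is_derivation_vector_field)

lemma is_derivation_dual_weitzenboeck: "is_derivation (dual_weitzenboeck n x)"
  unfolding dual_weitzenboeck_def[abs_def] by (rule is_derivation_vector_field)

lemma is_derivation_D_sub: "is_derivation (D_sub n x s)"
  unfolding D_sub_def[abs_def] by (rule is_derivation_vector_field)

lemma dual_weitzenboeck_Var:
  assumes "bij_betw x {1..n} UNIV" "i \<in> {1..n}"
  shows "dual_weitzenboeck n x (Var (x i)) = of_nat (i * (n - i)) * Var (x (i + 1))"
proof -
  have "dual_weitzenboeck n x (Var (x i)) =
      (\<Sum>j\<in>{1..<n}. if j = i then of_nat (i * (n - i)) * Var (x (i + 1)) else 0)"
    unfolding dual_weitzenboeck_def
  proof (rule sum.cong)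
    fix j assume "j \<in> {1..<n}"
    then have "x j = x i \<longleftrightarrow> j = i"
      using assms by (auto simp: bij_betw_def dest: inj_onD)
    then show "of_nat (j * (n - j)) * Var (x (j + 1)) * partial (x j) (Var (x i)) =
        (if j = i then of_nat (i * (n - i)) * Var (x (i + 1)) else 0)"
      by (simp add: partial_Var)
  qed simp
  also have "\<dots> = of_nat (i * (n - i)) * Var (x (i + 1))"
    using assms(2) by (cases "i = n") (auto simp: sum.delta)
  finally show ?thesis .
qed

end

theory Submission
  imports Defs
begin

text \<open>
  A derivation \<open>T\<close> commuting with \<open>D\<close> is determined by \<open>s = T x\<^sub>n\<close>, since \<open>D x\<^sub>i = x\<^sub>i\<^sub>-\<^sub>1\<close> forces
  \<open>T x\<^sub>i = D\<^sup>n\<^sup>-\<^sup>i s\<close>; the only condition on \<open>s\<close> is \<open>D\<^sup>n s = 0\<close>.  So the centralizer is the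
  \<open>Ker D\<close>-module \<open>Ker D\<^sup>n\<close>.  Together with its dual \<open>D'\<close>, the derivation \<open>D\<close> generates an action of
  \<open>sl\<^sub>2\<close> that is diagonalizable with respect to \<open>[D, D']\<close> and on which \<open>D'\<close> is locally nilpotent.
  For such an action \<open>Ker D\<^sup>n\<close> is spanned by the elements \<open>D'\<^sup>k h\<close> with \<open>k < n\<close> and \<open>D h = 0\<close>.
  Writing \<open>h\<close> as a polynomial in the generators \<open>a\<^sub>i\<close> and expanding \<open>D'\<^sup>k h\<close> by the Leibniz rule gives
  products of iterated \<open>D'\<close>-derivatives of the \<open>a\<^sub>i\<close> of total order \<open>k\<close>, whose factors of order \<open>0\<close>
  lie in \<open>Ker D\<close> and are absorbed into the coefficients.
\<close>

subsection \<open>Kernels of powers of the raising operator\<close>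

text \<open>The last two assumptions are \<open>[H, E] = 2 E\<close> and
  \<open>[H, F] = - 2 F\<close> with \<open>H = [E, F]\<close> written out, since \<open>H\<close>
  is only defined inside the locale. The space may be infinite-dimensional.\<close>

locale sl2_pair = vector_space scale
  for scale :: "'k::field_char_0 \<Rightarrow> 'b::ab_group_add \<Rightarrow> 'b" +
  fixes E F :: "'b \<Rightarrow> 'b"
  assumes E_add: "E (v + w) = E v + E w" and E_scale: "E (scale c v) = scale c (E v)"
    and F_add: "F (v + w) = F v + F w" and F_scale: "F (scale c v) = scale c (F v)"
    and H_E: "E (F (E v)) - F (E (E v)) = E (E (F v) - F (E v)) + scale 2 (E v)"
    and H_F: "E (F (F v)) - F (E (F v)) = F (E (F v) - F (E v)) - scale 2 (F v)"
begin

section \<open>Commutation formulas for powers of \<open>E\<close> and \<open>F\<close>\<close>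

definition H :: "'b \<Rightarrow> 'b" where
  "H v = E (F v) - F (E v)"

definition weight_space :: "'k \<Rightarrow> 'b set" where
  "weight_space c = {v. H v = scale c v}"

lemma E_zero [simp]: "E 0 = 0" and F_zero [simp]: "F 0 = 0"
  using E_add[of 0 0] F_add[of 0 0] by simp_all

lemma E_diff: "E (v - w) = E v - E w" and F_diff: "F (v - w) = F v - F w"
  using E_add[of "v - w" w] F_add[of "v - w" w] by (simp_all add: algebra_simps)

lemma H_add: "H (v + w) = H v + H w" and H_scale: "H (scale c v) = scale c (H v)"
  by (simp_all add: H_def E_add F_add E_scale F_scale scale_right_diff_distrib)

lemma H_zero [simp]: "H 0 = 0"
  by (simp add: H_def)

lemma H_E': "H (E v) = E (H v) + scale 2 (E v)" and H_F': "H (F v) = F (H v) - scale 2 (F v)"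
  using H_E[of v] H_F[of v] by (simp_all add: H_def)

lemma E_pow_zero [simp]: "(E ^^ m) 0 = 0" and F_pow_zero [simp]: "(F ^^ m) 0 = 0"
  by (induction m) auto

lemma E_pow_add: "(E ^^ m) (v + w) = (E ^^ m) v + (E ^^ m) w"
  by (induction m) (auto simp: E_add)

lemma E_pow_diff: "(E ^^ m) (v - w) = (E ^^ m) v - (E ^^ m) w"
  by (induction m) (auto simp: E_diff)

lemma E_pow_scale: "(E ^^ m) (scale c v) = scale c ((E ^^ m) v)"
  by (induction m) (auto simp: E_scale)

lemma F_pow_scale: "(F ^^ m) (scale c v) = scale c ((F ^^ m) v)"
  by (induction m) (auto simp: F_scale)

lemma E_pow_H: "(E ^^ m) (H v) = H ((E ^^ m) v) - scale (of_nat (2 * m)) ((E ^^ m) v)"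
proof (induction m)
  case (Suc m)
  then have "E ((E ^^ m) (H v)) = E (H ((E ^^ m) v) - scale (of_nat (2 * m)) ((E ^^ m) v))"
    by simp
  then show ?case
    by (simp add: H_E' E_diff E_scale scale_left_distrib algebra_simps)
qed simp

lemma H_F_pow: "H ((F ^^ k) v) = (F ^^ k) (H v) - scale (of_nat (2 * k)) ((F ^^ k) v)"
proof (induction k)
  case (Suc k)
  have "H ((F ^^ Suc k) v) = F (H ((F ^^ k) v)) - scale 2 ((F ^^ Suc k) v)"
    by (simp add: H_F')
  also have "\<dots> = F ((F ^^ k) (H v) - scale (of_nat (2 * k)) ((F ^^ k) v)) -
      scale 2 ((F ^^ Suc k) v)"
    by (simp only: Suc)
  finally show ?case
    by (simp add: F_diff F_scale scale_left_distrib algebra_simps)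
qed simp

lemma weight_space_E_pow:
  assumes "v \<in> weight_space c"
  shows "(E ^^ m) v \<in> weight_space (c + of_nat (2 * m))"
  using assms E_pow_H[of m v]
  by (simp add: weight_space_def E_pow_scale scale_left_distrib algebra_simps)

lemma weight_space_E:
  assumes "v \<in> weight_space c"
  shows "E v \<in> weight_space (c + 2)"
  using weight_space_E_pow[OF assms, of 1] by simp

lemma weight_space_F:
  assumes "v \<in> weight_space c"
  shows "F v \<in> weight_space (c - 2)"
  using assms H_F_pow[of 1 v]
  by (simp add: weight_space_def F_scale scale_left_diff_distrib)

lemma subspace_weight_space: "subspace (weight_space c)"
  by (auto simp: subspace_def weight_space_def H_add H_scale scale_right_distrib mult.commute)

text \<open>Moving \<open>F\<close> past each of the \<open>m\<close> factors \<open>E\<close>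
  produces one \<open>H\<close>, evaluated at the weights
  \<open>c, c + 2, ..., c + 2 (m - 1)\<close>; their sum is \<open>m (c + m - 1)\<close>. At
  \<open>m = 0\<close> the coefficient vanishes, so the truncated exponent is harmless.\<close>

lemma E_pow_F:
  assumes "v \<in> weight_space c"
  shows "(E ^^ m) (F v) =
    F ((E ^^ m) v) + scale (of_nat m * (c + of_nat m - 1)) ((E ^^ (m - 1)) v)"
proof (induction m)
  case (Suc m)
  have "E (F ((E ^^ m) v)) = F (E ((E ^^ m) v)) + scale (c + of_nat (2 * m)) ((E ^^ m) v)"
    using weight_space_E_pow[OF assms, of m] by (simp add: weight_space_def H_def algebra_simps)
  moreover have "scale (of_nat m * (c + of_nat m - 1)) (E ((E ^^ (m - 1)) v)) =
      scale (of_nat m * (c + of_nat m - 1)) ((E ^^ m) v)"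
    by (cases m) auto
  moreover have "of_nat (Suc m) * (c + of_nat (Suc m) - 1) =
      c + of_nat (2 * m) + of_nat m * (c + of_nat m - 1)"
    by (simp add: algebra_simps)
  ultimately show ?case
    by (simp only: Suc E_add E_scale funpow.simps comp_def diff_Suc_1 scale_left_distrib add.assoc)
qed simp

text \<open>The counterpart for powers of \<open>F\<close>, with \<open>H\<close> kept as an
  operator so that it applies to vectors that are not weight vectors.\<close>

lemma E_F_pow:
  "E ((F ^^ Suc k) v) =
    (F ^^ Suc k) (E v) + scale (of_nat (Suc k)) ((F ^^ k) (H v - scale (of_nat k) v))"
proof (induction k)
  case 0
  then show ?case by (simp add: H_def)
next
  case (Suc k)
  have F_pow_diff: "(F ^^ j) (u - w) = (F ^^ j) u - (F ^^ j) w" for j u w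
    by (induction j) (auto simp: F_diff)
  have double: "scale 2 w = w + w" for w
    using scale_left_distrib[of 1 1 w] by simp
  have "E ((F ^^ Suc (Suc k)) v) = F (E ((F ^^ Suc k) v)) + H ((F ^^ Suc k) v)"
    by (simp add: H_def)
  also have "\<dots> = (F ^^ Suc (Suc k)) (E v) +
      scale (of_nat (Suc k)) ((F ^^ Suc k) (H v - scale (of_nat k) v)) +
      ((F ^^ Suc k) (H v) - scale (of_nat (2 * Suc k)) ((F ^^ Suc k) v))"
    unfolding Suc H_F_pow by (simp add: F_add F_scale)
  also have "\<dots> = (F ^^ Suc (Suc k)) (E v) +
      scale (of_nat (Suc (Suc k))) ((F ^^ Suc k) (H v - scale (of_nat (Suc k)) v))"
    unfolding F_pow_diff F_pow_scale
    by (simp add: algebra_simps scale_left_distrib double)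
  finally show ?case .
qed

text \<open>One \<open>E\<close> turns \<open>F^(k+1) v\<close> into a multiple of
  \<open>F^k\<close> applied to \<open>H v - k v\<close>, which \<open>E\<close> kills again because
  \<open>[H, E] = 2 E\<close>. The vector changes at each step, hence the induction over all
  \<open>v\<close>.\<close>

lemma E_pow_F_pow_eq_0:
  assumes "E v = 0"
  shows "(E ^^ Suc k) ((F ^^ k) v) = 0"
  using assms
proof (induction k arbitrary: v)
  case (Suc k)
  have "E (H v - scale (of_nat k) v) = 0"
    using E_pow_H[of 1 v] Suc.prems by (simp add: E_diff E_scale)
  from Suc.IH[OF this] show ?case
    unfolding funpow_Suc_right[of "Suc k" E] comp_def E_F_pow
    by (simp only: Suc.prems E_pow_add E_pow_scale F_pow_zero E_pow_zero scale_zero_right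
        add_0_left)
qed simp

text \<open>
  Modulo the vectors killed by \<open>E\<^sup>m\<close>, the operator \<open>F E\<close> acts on the vectors of weight \<open>c\<close> killed by
  \<open>E\<^sup>m\<^sup>+\<^sup>1\<close> as the scalar \<open>m (c + m + 1)\<close>.  This drives both inductions below: a vector is recovered
  from \<open>F (E v)\<close> unless \<open>c = - (m + 1)\<close>, and in that case it vanishes.
\<close>

lemma F_E_minus_scale:
  assumes "v \<in> weight_space c" "(E ^^ Suc m) v = 0"
  shows "(E ^^ m) (F (E v) - scale (of_nat m * (c + of_nat m + 1)) v) = 0"
proof -
  have "(E ^^ (m - 1)) (E v) = (E ^^ m) v" if "m \<noteq> 0"
    using that by (cases m) (auto simp: funpow_swap1)
  moreover have "(E ^^ m) (E v) = 0"
    using assms(2) by (simp add: funpow_swap1)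
  ultimately show ?thesis
    using E_pow_F[OF weight_space_E[OF assms(1)], of m]
    by (cases "m = 0") (simp_all add: E_pow_diff E_pow_scale add_ac)
qed

end

section \<open>Kernels of powers of \<open>E\<close> on a single weight space\<close>

locale lowering_nilpotent_sl2_pair = sl2_pair +
  assumes F_nilpotent: "\<exists>N. (F ^^ N) v = 0"
begin

text \<open>If \<open>F^(k+1) v = 0\<close>, then \<open>E_F_pow\<close> leaves
  \<open>(k+1) (- p - k) F^k v = 0\<close>, and this scalar is nonzero. Local nilpotency provides
  some vanishing power of \<open>F\<close>, from which one descends to \<open>v\<close>
  itself.\<close>

lemma F_E_eq_0_negative_weight:
  assumes "v \<in> weight_space (- of_nat p)" "p > 0" "F (E v) = 0"
  shows "v = 0"
proof -
  have step: "(F ^^ k) v = 0" if "(F ^^ Suc k) v = 0" for k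
  proof -
    have "(F ^^ Suc k) (E v) = 0"
      using assms(3) by (simp add: funpow_swap1)
    with E_F_pow[of k v] that assms(1)
    have "0 = scale (of_nat (Suc k)) ((F ^^ k) (scale (- of_nat p - of_nat k) v))"
      by (simp add: weight_space_def scale_left_diff_distrib)
    then have "scale (of_nat (Suc k) * (- of_nat p - of_nat k)) ((F ^^ k) v) = 0"
      by (simp add: F_pow_scale)
    moreover have "(- of_nat p - of_nat k :: 'a) \<noteq> 0"
    proof -
      have "(- of_nat p - of_nat k :: 'a) = - of_nat (p + k)" by simp
      then show ?thesis using assms(2) by (simp del: of_nat_add)
    qed
    ultimately show ?thesis
      by (simp del: of_nat_Suc)
  qed
  from F_nilpotent obtain N where "(F ^^ N) v = 0" by blast
  then show ?thesis
    by (induction N) (use step in auto)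
qed

lemma E_pow_inj_negative_weight:
  assumes "v \<in> weight_space (- of_nat p)" "m \<le> p" "(E ^^ m) v = 0"
  shows "v = 0"
  using assms
proof (induction m arbitrary: v p)
  case (Suc m)
  let ?c = "of_nat m * (- of_nat p + of_nat m + 1) :: 'a"
  have "F (E v) \<in> weight_space (- of_nat p)"
    using weight_space_F[OF weight_space_E[OF Suc.prems(1)]] by simp
  then have "F (E v) - scale ?c v \<in> weight_space (- of_nat p)"
    using Suc.prems(1) by (intro subspace_diff subspace_scale subspace_weight_space)
  from Suc.IH[OF this] F_E_minus_scale[OF Suc.prems(1,3)] Suc.prems(2)
  \<comment> \<open>The difference is killed by \<open>E^m\<close> and has the same weight, so the
    induction hypothesis makes it vanish. The scalar is zero exactly when \<open>m = 0\<close> or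
    \<open>p = m + 1\<close>.\<close>
  have FE: "F (E v) = scale ?c v" by simp
  show ?case
  proof (cases "p = Suc m")
    case True
    then show ?thesis
      using FE F_E_eq_0_negative_weight[OF Suc.prems(1)] by simp
  next
    \<comment> \<open>Now \<open>m + 2 \<le> p\<close>: the subtraction \<open>p - 2\<close> is not
      truncated, and \<open>m \<le> p - 2\<close> lets the induction hypothesis apply to
      \<open>E v\<close>.\<close>
    case False
    then have "- of_nat p + 2 = (- of_nat (p - 2) :: 'a)"
      using Suc.prems(2) by (simp add: of_nat_diff)
    then have "E v \<in> weight_space (- of_nat (p - 2))"
      using weight_space_E[OF Suc.prems(1)] by simp
    moreover have "(E ^^ m) (E v) = 0"
      using Suc.prems(3) by (simp add: funpow_swap1)
    ultimately have "E v = 0"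
      using False Suc.prems(2) by (intro Suc.IH[of "E v" "p - 2"]) simp_all
    then show ?thesis
      using F_E_eq_0_negative_weight[OF Suc.prems(1)] Suc.prems(2) by simp
  qed
qed simp

lemma F_span:
  assumes "v \<in> span {(F ^^ k) h | k h. k < m \<and> E h = 0}"
  shows "F v \<in> span {(F ^^ k) h | k h. k < Suc m \<and> E h = 0}"
  using assms
proof (induction rule: span_induct_alt)
  case base
  then show ?case by (simp add: span_zero)
next
  case (step c w u)
  then obtain k h where "w = (F ^^ k) h" "k < m" "E h = 0" by blast
  then have "F w \<in> span {(F ^^ k) h | k h. k < Suc m \<and> E h = 0}"
    by (intro span_base CollectI exI[of _ "Suc k"] exI[of _ h]) simp
  with step(2) show ?case
    by (simp add: F_add F_scale span_add span_scale)
qed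

lemma weight_kernel_E_pow:
  assumes "v \<in> weight_space c" "(E ^^ m) v = 0"
  shows "v \<in> span {(F ^^ k) h | k h. k < m \<and> E h = 0}"
  using assms
proof (induction m arbitrary: v c)
  case (Suc m)
  let ?S = "\<lambda>m. span {(F ^^ k) h | k h. k < m \<and> E h = 0}"
  let ?d = "of_nat m * (c + of_nat m + 1)"
  have mono: "?S m \<subseteq> ?S (Suc m)"
    by (rule span_mono) (blast intro: less_SucI)
  have "F (E v) \<in> weight_space c"
    using weight_space_F[OF weight_space_E[OF Suc.prems(1)]] by simp
  then have "F (E v) - scale ?d v \<in> weight_space c"
    using Suc.prems(1) by (intro subspace_diff subspace_scale subspace_weight_space)
  then have rest: "F (E v) - scale ?d v \<in> ?S (Suc m)"
    using Suc.IH[OF _ F_E_minus_scale[OF Suc.prems]] mono by blast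
  have "(E ^^ m) (E v) = 0"
    using Suc.prems(2) by (simp add: funpow_swap1)
  \<comment> \<open>The vector \<open>E v\<close> is killed by \<open>E^m\<close>, so it is covered
    by induction; the extra \<open>F\<close> costs one more in the bound on
    \<open>k\<close>.\<close>
  then have FE: "F (E v) \<in> ?S (Suc m)"
    using Suc.IH[OF weight_space_E[OF Suc.prems(1)]] by (intro F_span)
  show ?case
  proof (cases "?d = 0")
    case False
    have "scale ?d v \<in> ?S (Suc m)"
      using span_diff[OF FE rest] by simp
    then have "scale (1 / ?d) (scale ?d v) \<in> ?S (Suc m)"
      by (rule span_scale)
    then show ?thesis using False by simp
  next
    case True
    show ?thesis
    proof (cases "m = 0")
      case True
      then show ?thesis
        using Suc.prems(2) by (intro span_base CollectI exI[of _ 0] exI[of _ v]) auto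
    next
      case False
      with True have "c + of_nat (Suc m) = 0"
        by (simp add: add_ac)
      then have "c = - of_nat (Suc m)"
        by (simp only: eq_neg_iff_add_eq_0)
      then have "v = 0"
        using E_pow_inj_negative_weight[of v "Suc m" "Suc m"] Suc.prems by simp
      then show ?thesis by (simp add: span_zero)
    qed
  qed
qed (simp add: span_zero)

end

section \<open>Decomposition into weight components\<close>

context sl2_pair
begin

text \<open>The usual independence argument for eigenvectors: \<open>H - d\<close> removes the
  component of weight \<open>d\<close> and multiplies each other component by the nonzero scalar
  \<open>c - d\<close>, so the induction hypothesis applies to the rescaled family.\<close>

lemma weight_components_in_subspace:
  assumes "finite C" "\<And>c. c \<in> C \<Longrightarrow> g c \<in> weight_space c"
    and U: "subspace U" "\<And>u. u \<in> U \<Longrightarrow> H u \<in> U" and "sum g C \<in> U"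
  shows "\<forall>c\<in>C. g c \<in> U"
  using assms(1,2,5)
proof (induction C arbitrary: g rule: finite_induct)
  case (insert d C)
  have H_sum: "H (sum g B) = (\<Sum>c\<in>B. H (g c))" for B
    by (induction B rule: infinite_finite_induct) (auto simp: H_add)
  let ?u = "sum g (insert d C)"
  have "(\<Sum>c\<in>C. scale (c - d) (g c)) = (\<Sum>c\<in>insert d C. scale (c - d) (g c))"
    using insert.hyps by simp
  also have "\<dots> = (\<Sum>c\<in>insert d C. H (g c)) - scale d ?u"
    unfolding scale_sum_right sum_subtractf[symmetric]
    using insert.prems(1) by (intro sum.cong) (auto simp: weight_space_def scale_left_diff_distrib)
  also have "\<dots> = H ?u - scale d ?u"
    by (simp only: H_sum)
  finally have "(\<Sum>c\<in>C. scale (c - d) (g c)) \<in> U"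
    using insert.prems(2) U by (simp only: subspace_diff subspace_scale)
  moreover have "scale (c - d) (g c) \<in> weight_space c" if "c \<in> C" for c
    using that insert.prems(1) by (simp add: subspace_scale subspace_weight_space)
  ultimately have *: "\<forall>c\<in>C. scale (c - d) (g c) \<in> U"
    using insert.IH[of "\<lambda>c. scale (c - d) (g c)"] by blast
  have C: "g c \<in> U" if "c \<in> C" for c
  proof -
    have "c - d \<noteq> 0" using that insert.hyps by auto
    moreover have "scale (1 / (c - d)) (scale (c - d) (g c)) \<in> U"
      using * that U(1) by (simp only: subspace_scale)
    ultimately show ?thesis by simp
  qed
  then have "sum g C \<in> U" by (intro subspace_sum U)
  with insert.prems(2) have "?u - sum g C \<in> U" using U(1) by (simp only: subspace_diff)
  then have "g d \<in> U" using insert.hyps by simp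
  with C show ?case by auto
qed simp

lemma span_weight_spaces:
  assumes "v \<in> span (\<Union>c. weight_space c)"
  obtains C g where "finite C" "\<And>c. g c \<in> weight_space c" "v = sum g C"
proof -
  \<comment> \<open>Requiring \<open>g\<close> to vanish outside \<open>C\<close> lets a new vector
    of weight \<open>d\<close> be added to \<open>g d\<close> whether or not \<open>d\<close>
    already belongs to \<open>C\<close>.\<close>
  have "\<exists>C g. finite C \<and> (\<forall>c. g c \<in> weight_space c) \<and> (\<forall>c. c \<notin> C \<longrightarrow> g c = 0) \<and> v = sum g C"
    using assms
  proof (induction rule: span_induct_alt)
    case base
    have "0 \<in> weight_space c" for c
      by (rule subspace_0[OF subspace_weight_space])
    then show ?case by (intro exI[of _ "{}"] exI[of _ "\<lambda>_. 0"]) auto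
  next
    case (step b w u)
    then obtain d where d: "w \<in> weight_space d" by blast
    from step(2) obtain C g where g: "finite C" "\<forall>c. g c \<in> weight_space c"
      "\<forall>c. c \<notin> C \<longrightarrow> g c = 0" "u = sum g C" by blast
    let ?g = "g(d := scale b w + g d)"
    have "sum ?g (insert d C) = scale b w + g d + sum g (C - {d})"
      using g(1) by (simp add: sum.insert_remove)
    also have "g d + sum g (C - {d}) = u"
      using g by (cases "d \<in> C") (auto simp: sum.remove)
    then have "scale b w + g d + sum g (C - {d}) = scale b w + u"
      by (simp add: add.assoc)
    finally have "scale b w + u = sum ?g (insert d C)" ..
    moreover have "?g c \<in> weight_space c" for c
      using d g(2) by (auto intro!: subspace_add subspace_scale subspace_weight_space)
    ultimately show ?case
      using g by (intro exI[of _ "insert d C"] exI[of _ ?g]) auto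
  qed
  then show ?thesis using that by (elim exE conjE) blast
qed

end

text \<open>By \<open>E_pow_H\<close> the kernel of \<open>E^m\<close> is stable under
  \<open>H\<close>, so it contains the weight components of \<open>v\<close>, and each of them is
  covered by \<open>weight_kernel_E_pow\<close>.\<close>

theorem (in lowering_nilpotent_sl2_pair) kernel_E_pow:
  assumes "v \<in> span (\<Union>c. weight_space c)" "(E ^^ m) v = 0"
  shows "v \<in> span {(F ^^ k) h | k h. k < m \<and> E h = 0}"
proof -
  from span_weight_spaces[OF assms(1)] obtain C g where
    g: "finite C" "\<And>c. g c \<in> weight_space c" "v = sum g C" by blast
  let ?U = "{u. (E ^^ m) u = 0}"
  have U: "subspace ?U"
    by (auto simp: subspace_def E_pow_add E_pow_scale)
  have "H u \<in> ?U" if "u \<in> ?U" for u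
    using that by (simp add: E_pow_H)
  then have "\<forall>c\<in>C. g c \<in> ?U"
    using g assms(2) by (intro weight_components_in_subspace U) auto
  then have "g c \<in> span {(F ^^ k) h | k h. k < m \<and> E h = 0}" if "c \<in> C" for c
    using that g(2) by (intro weight_kernel_E_pow) auto
  then show ?thesis unfolding g(3) by (intro span_sum)
qed

subsection \<open>Derivations of the polynomial ring\<close>

context
  fixes T :: "('k::comm_ring_1, 'v::finite) mpoly \<Rightarrow> ('k, 'v) mpoly"
  assumes T: "is_derivation T"
begin

lemma derivation_add: "T (f + g) = T f + T g"
  and derivation_scale: "T (Const c * f) = Const c * T f"
  and derivation_mult: "T (f * g) = T f * g + f * T g"
  using T by (auto simp: is_derivation_def)

lemma derivation_zero: "T 0 = 0"
  using derivation_add[of 0 0] by simp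

lemma derivation_one: "T 1 = 0"
  using derivation_mult[of 1 1] by simp

lemma derivation_Const: "T (Const c) = 0"
  using derivation_scale[of c 1] by (simp add: derivation_one)

lemma derivation_diff: "T (f - g) = T f - T g"
  using derivation_add[of "f - g" g] by (simp add: algebra_simps)

lemma derivation_pow_zero: "(T ^^ k) 0 = 0"
  by (induction k) (auto simp: derivation_zero)

lemma derivation_pow_add: "(T ^^ k) (f + g) = (T ^^ k) f + (T ^^ k) g"
  by (induction k) (auto simp: derivation_add)

lemma derivation_pow_mult_kernel: "T c = 0 \<Longrightarrow> (T ^^ k) (c * f) = c * (T ^^ k) f"
  by (induction k) (auto simp: derivation_mult)

text \<open>In each Leibniz term the two orders add up to \<open>p + q - 1\<close>, so one of them
  reaches its bound. Induction on \<open>p + q\<close> avoids binomial coefficients;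
  \<open>p = 0\<close> or \<open>q = 0\<close> means that a factor is zero.\<close>

lemma derivation_pow_mult_eq_0:
  assumes "(T ^^ p) f = 0" "(T ^^ q) g = 0"
  shows "(T ^^ (p + q - 1)) (f * g) = 0"
  using assms
proof (induction "p + q" arbitrary: p q f g)
  case (Suc s)
  show ?case
  proof (cases "p = 0 \<or> q = 0")
    case True
    then show ?thesis using Suc.prems by (auto simp: derivation_pow_zero)
  next
    case False
    then obtain p' q' where pq: "p = Suc p'" "q = Suc q'"
      by (auto simp: gr0_conv_Suc)
    have "(T ^^ (p' + q - 1)) (T f * g) = 0"
      using Suc.hyps(2) Suc.prems pq by (intro Suc.hyps(1)) (auto simp: funpow_swap1)
    moreover have "(T ^^ (p + q' - 1)) (f * T g) = 0"
      using Suc.hyps(2) Suc.prems pq by (intro Suc.hyps(1)) (auto simp: funpow_swap1)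
    moreover have "(T ^^ Suc (p' + q')) (f * g) =
        (T ^^ (p' + q')) (T f * g) + (T ^^ (p' + q')) (f * T g)"
      by (simp add: funpow_swap1 derivation_mult derivation_pow_add)
    ultimately show ?thesis by (simp add: pq)
  qed
qed simp

end

section \<open>Constants, induction principles and closure properties of derivations\<close>

lemma of_nat_eq_Const: "of_nat k = (Const (of_nat k) :: ('k::comm_ring_1, 'v::finite) mpoly)"
  by (induction k) (auto simp: Const_def single_add simp flip: single_one)

lemma Const_add: "Const (c + d) = Const c + Const d"
  and Const_mult: "Const (c * d) = Const c * Const d"
  and Const_1: "Const 1 = 1"
  by (simp_all add: Const_def single_add mult_single)

lemma Const_diff: "Const (c - d) = Const c - Const d"
  by (metis Const_add diff_add_cancel eq_diff_eq)

text \<open>Induction on the total degree. It involves no sums, so it suits properties not closed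
  under addition, such as being a weight vector.\<close>

lemma monomial_induct [case_names Const Var_mult]:
  fixes m :: "'v::finite \<Rightarrow>\<^sub>0 nat" and c :: "'k::comm_ring_1"
  assumes "P (Const c)" "\<And>v f. P f \<Longrightarrow> P (Var v * f)"
  shows "P (Poly_Mapping.single m c)"
proof (induction "\<Sum>v\<in>UNIV. Poly_Mapping.lookup m v" arbitrary: m)
  case 0
  then have "m = 0" by (intro poly_mapping_eqI) simp
  then show ?case using assms(1) by (simp add: Const_def)
next
  case (Suc s)
  then obtain v where v: "Poly_Mapping.lookup m v \<noteq> 0"
    by (metis (no_types, lifting) sum.neutral Zero_not_Suc)
  define m' where "m' = m - Poly_Mapping.single v 1"
  have m: "m = Poly_Mapping.single v 1 + m'"
    unfolding m'_def
    by (rule poly_mapping_eqI) (use v in \<open>auto simp: lookup_add lookup_minus lookup_single when_def\<close>)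
  have "(\<Sum>w\<in>UNIV. Poly_Mapping.lookup m w) = Suc (\<Sum>w\<in>UNIV. Poly_Mapping.lookup m' w)"
    unfolding m by (simp add: lookup_add lookup_single when_def sum.distrib)
  with Suc have "P (Poly_Mapping.single m' c)" by simp
  then have "P (Var v * Poly_Mapping.single m' c)" by (rule assms(2))
  then show ?case by (simp add: Var_def mult_single m)
qed

lemma mpoly_ring_induct [case_names Const Var add mult]:
  fixes f :: "('k::comm_ring_1, 'v::finite) mpoly"
  assumes "\<And>c. P (Const c)" "\<And>v. P (Var v)"
    "\<And>f g. P f \<Longrightarrow> P g \<Longrightarrow> P (f + g)" "\<And>f g. P f \<Longrightarrow> P g \<Longrightarrow> P (f * g)"
  shows "P f"
proof (induction f rule: mpoly_induct)
  case zero
  then show ?case using assms(1)[of 0] by (simp add: Const_def)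
next
  case (single m c)
  then show ?case by (induction rule: monomial_induct) (auto intro: assms)
qed (rule assms)

lemma derivation_eqI:
  assumes "is_derivation T" "is_derivation U" "\<And>v. T (Var v) = U (Var v)"
  shows "T f = U f"
  by (induction f rule: mpoly_ring_induct)
    (simp_all add: assms derivation_Const derivation_add derivation_mult)

lemma is_derivation_iff:
  "is_derivation T \<longleftrightarrow> (\<forall>f g. T (f + g) = T f + T g) \<and> (\<forall>c. T (Const c) = 0) \<and>
    (\<forall>f g. T (f * g) = T f * g + f * T g)"
  using derivation_Const[of T] by (auto simp: is_derivation_def)

lemma is_derivation_lie_bracket:
  assumes "is_derivation T" "is_derivation U"
  shows "is_derivation (lie_bracket T U)"
  unfolding is_derivation_iff lie_bracket_def
  by (simp add: derivation_add[OF assms(1)] derivation_add[OF assms(2)]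
      derivation_Const[OF assms(1)] derivation_Const[OF assms(2)]
      derivation_zero[OF assms(1)] derivation_zero[OF assms(2)]
      derivation_mult[OF assms(1)] derivation_mult[OF assms(2)] algebra_simps)

lemma is_derivation_add:
  "is_derivation T \<Longrightarrow> is_derivation U \<Longrightarrow> is_derivation (\<lambda>f. T f + U f)"
  by (simp add: is_derivation_iff algebra_simps)

lemma is_derivation_mult_left:
  "is_derivation T \<Longrightarrow> is_derivation (\<lambda>f. p * T f)"
  by (simp add: is_derivation_iff algebra_simps)

lemma is_derivation_zero: "is_derivation (\<lambda>f. 0)"
  by (simp add: is_derivation_def)

lemma derivation_eq_0I:
  assumes "is_derivation T" "\<And>v. T (Var v) = 0"
  shows "T f = 0"
  using derivation_eqI[OF assms(1) is_derivation_zero] assms(2) by blast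

text \<open>Think of \<open>M\<close> as a family of subspaces graded by order. One application of
  \<open>T\<close> raises the order of one factor by one, so \<open>p\<close> and \<open>q\<close>
  must vary in the induction.\<close>

lemma derivation_Leibniz_closed:
  assumes T: "is_derivation T"
    and add: "\<And>k f g. f \<in> M k \<Longrightarrow> g \<in> M k \<Longrightarrow> f + g \<in> M k"
    and mult: "\<And>i j f g. f \<in> M i \<Longrightarrow> g \<in> M j \<Longrightarrow> f * g \<in> M (i + j :: nat)"
    and "\<And>k. (T ^^ k) f \<in> M (p + k)" "\<And>k. (T ^^ k) g \<in> M (q + k)"
  shows "(T ^^ k) (f * g) \<in> M (p + q + k)"
  using assms(4,5)
proof (induction k arbitrary: f g p q)
  case 0
  then show ?case using mult[of f p g q] by (metis add_0_right funpow_0)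
next
  case (Suc k)
  have "(T ^^ k) (T f * g) \<in> M (Suc p + q + k)" "(T ^^ k) (f * T g) \<in> M (p + Suc q + k)"
    using Suc.IH[of "T f" "Suc p" g q] Suc.IH[of f p "T g" "Suc q"]
      Suc.prems(1)[of "Suc _"] Suc.prems(2)[of "Suc _"] Suc.prems
    by (simp_all add: funpow_swap1)
  then show ?case
    by (simp add: funpow_swap1 derivation_mult[OF T] derivation_pow_add[OF T] add)
qed

lemma D_sub_add: "D_sub n x (s + t) = (\<lambda>f. D_sub n x s f + D_sub n x t f)"
  by (simp add: D_sub_def derivation_pow_add[OF is_derivation_weitzenboeck] distrib_right sum.distrib
      fun_eq_iff)

subsection \<open>The Weitzenboeck derivation and its dual\<close>

text \<open>The parameter \<open>K\<close> only pins down the coefficient type, which occurs in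
  neither \<open>n\<close> nor \<open>x\<close>.\<close>

locale ordered_variables =
  fixes n :: nat and x :: "nat \<Rightarrow> 'v::finite" and K :: "'k::field_char_0 itself"
  assumes bij: "bij_betw x {1..n} (UNIV :: 'v set)"
begin

abbreviation D :: "('k, 'v) mpoly \<Rightarrow> ('k, 'v) mpoly" where
  "D \<equiv> weitzenboeck n x"

abbreviation D' :: "('k, 'v) mpoly \<Rightarrow> ('k, 'v) mpoly" where
  "D' \<equiv> dual_weitzenboeck n x"

lemma derivation_D: "is_derivation D" and derivation_D': "is_derivation D'"
  by (rule is_derivation_weitzenboeck is_derivation_dual_weitzenboeck)+

lemma Var_cases:
  obtains i where "i \<in> {1..n}" "v = x i"
  using bij by (metis UNIV_I bij_betw_iff_bijections)

lemma n_pos: "n > 0"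
  using bij by (cases n) (auto simp: bij_betw_def)

lemma partial_Var_x:
  assumes "i \<in> {1..n}" "j \<in> {1..n}"
  shows "partial (x i) (Var (x j)) = (if i = j then 1 else 0)"
  using assms bij by (auto simp: partial_Var bij_betw_def dest: inj_onD)

lemma D_Var: "i \<in> {1..n} \<Longrightarrow> D (Var (x i)) = (if i = 1 then 0 else Var (x (i - 1)))"
proof -
  assume i: "i \<in> {1..n}"
  have "D (Var (x i)) = (\<Sum>j\<in>{1..<n}. if j = i - 1 then Var (x j) else 0)"
    unfolding weitzenboeck_def using i by (intro sum.cong) (auto simp: partial_Var_x)
  then show ?thesis using i by (auto simp: sum.delta)
qed

lemma D'_Var: "i \<in> {1..n} \<Longrightarrow> D' (Var (x i)) = of_nat (i * (n - i)) * Var (x (i + 1))"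
  by (rule dual_weitzenboeck_Var[OF bij])

lemma D_sub_Var: "i \<in> {1..n} \<Longrightarrow> D_sub n x s (Var (x i)) = (D ^^ (n - i)) s"
proof -
  assume i: "i \<in> {1..n}"
  have "D_sub n x s (Var (x i)) = (\<Sum>j\<in>{1..n}. if j = i then (D ^^ (n - j)) s else 0)"
    unfolding D_sub_def using i by (intro sum.cong) (auto simp: partial_Var_x)
  then show ?thesis using i by (simp add: sum.delta)
qed

section \<open>The relations of \<open>sl_2\<close> and local nilpotency of
  \<open>D'\<close>\<close>

lemma of_nat_mult_D: "D (of_nat k * f) = of_nat k * D f"
  by (simp add: of_nat_eq_Const derivation_scale[OF derivation_D])

lemma of_nat_mult_D': "D' (of_nat k * f) = of_nat k * D' f"
  by (simp add: of_nat_eq_Const derivation_scale[OF derivation_D'])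

text \<open>The variables span the irreducible representation of dimension \<open>n\<close>, with
  weights \<open>n - 1, n - 3, ..., 1 - n\<close>. The weight is a difference of casts because it
  may be negative.\<close>

lemma lie_bracket_D_D'_Var:
  assumes "i \<in> {1..n}"
  shows "lie_bracket D D' (Var (x i)) = (of_nat (n + 1) - of_nat (2 * i)) * Var (x i)"
proof -
  have "D (D' (Var (x i))) = of_nat (i * (n - i)) * Var (x i)"
    using assms
    by (cases "i = n")
      (simp_all add: D'_Var of_nat_mult_D D_Var derivation_zero[OF derivation_D] del: of_nat_mult)
  moreover have "D' (D (Var (x i))) = of_nat ((i - 1) * (n - (i - 1))) * Var (x i)"
  proof (cases "i = 1")
    case False
    with assms have "i - 1 \<in> {1..n}" "i - 1 + 1 = i" by auto
    with D'_Var[of "i - 1"] assms False show ?thesis by (simp only: D_Var if_False)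
  qed (use assms in \<open>simp add: D_Var derivation_zero[OF derivation_D']\<close>)
  moreover have "(of_nat (i * (n - i)) - of_nat ((i - 1) * (n - (i - 1))) :: ('k, 'v) mpoly) =
      of_nat (n + 1) - of_nat (2 * i)"
  proof -
    define j where "j = i - 1"
    define k where "k = n - i"
    have jk: "i = Suc j" "n = Suc j + k"
      using assms by (auto simp: j_def k_def)
    have "i * (n - i) + 2 * i = (n + 1) + (i - 1) * (n - (i - 1))"
      unfolding jk by simp
    then have "of_nat (i * (n - i)) + of_nat (2 * i) =
        (of_nat (n + 1) + of_nat ((i - 1) * (n - (i - 1))) :: ('k, 'v) mpoly)"
      by (simp only: flip: of_nat_add)
    then show ?thesis by (simp only: diff_eq_eq diff_add_eq eq_diff_eq)
  qed
  ultimately show ?thesis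
    by (simp add: lie_bracket_def flip: left_diff_distrib)
qed

lemma two_eq_Const: "2 = (Const 2 :: ('k, 'v) mpoly)"
  using of_nat_eq_Const[of 2] by simp

lemma derivation_lie_bracket_D_D': "is_derivation (lie_bracket D D')"
  by (intro is_derivation_lie_bracket derivation_D derivation_D')

lemma D_weight_Var: "D ((of_nat a - of_nat b) * f) = (of_nat a - of_nat b) * D f"
  and D'_weight_Var: "D' ((of_nat a - of_nat b) * f) = (of_nat a - of_nat b) * D' f"
  by (simp_all only: left_diff_distrib of_nat_mult_D of_nat_mult_D'
      derivation_diff[OF derivation_D] derivation_diff[OF derivation_D'])

text \<open>Both sides are derivations, so the variables suffice: \<open>D\<close> lowers the index
  by one, which raises the weight by two.\<close>

lemma lie_bracket_H_D: "lie_bracket (lie_bracket D D') D f = 2 * D f"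
proof (rule derivation_eqI[where U = "\<lambda>f. 2 * D f"])
  fix v
  obtain i where i: "i \<in> {1..n}" "v = x i" by (rule Var_cases)
  show "lie_bracket (lie_bracket D D') D (Var v) = 2 * D (Var v)"
    unfolding lie_bracket_def[of "lie_bracket D D'"] i(2) lie_bracket_D_D'_Var[OF i(1)] D_weight_Var
  proof (cases "i = 1")
    case False
    with i(1) have "i - 1 \<in> {1..n}" by auto
    from lie_bracket_D_D'_Var[OF this] i(1) False
    show "lie_bracket D D' (D (Var (x i))) - (of_nat (n + 1) - of_nat (2 * i)) * D (Var (x i)) =
        2 * D (Var (x i))"
      by (simp add: D_Var of_nat_diff algebra_simps)
  qed (use i(1) in \<open>simp add: D_Var derivation_zero[OF derivation_lie_bracket_D_D']\<close>)
qed (intro is_derivation_lie_bracket is_derivation_mult_left derivation_D derivation_D')+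

lemma lie_bracket_H_D': "lie_bracket (lie_bracket D D') D' f = - 2 * D' f"
proof (rule derivation_eqI[where U = "\<lambda>f. - 2 * D' f"])
  fix v
  obtain i where i: "i \<in> {1..n}" "v = x i" by (rule Var_cases)
  show "lie_bracket (lie_bracket D D') D' (Var v) = - 2 * D' (Var v)"
  proof (cases "i = n")
    case True
    then show ?thesis
      unfolding lie_bracket_def[of "lie_bracket D D'"] i(2) lie_bracket_D_D'_Var[OF i(1)]
        D'_weight_Var
      using i(1) by (simp add: D'_Var derivation_zero[OF derivation_lie_bracket_D_D'])
  next
    case False
    let ?c = "of_nat (i * (n - i)) :: ('k, 'v) mpoly"
    have "lie_bracket D D' (?c * Var (x (i + 1))) = ?c * lie_bracket D D' (Var (x (i + 1)))"
      unfolding of_nat_eq_Const by (rule derivation_scale[OF derivation_lie_bracket_D_D'])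
    with False i(1) show ?thesis
      unfolding lie_bracket_def[of "lie_bracket D D'"] i(2) lie_bracket_D_D'_Var[OF i(1)]
        D'_weight_Var
      by (simp add: D'_Var lie_bracket_D_D'_Var algebra_simps del: of_nat_mult)
  qed
qed (intro is_derivation_lie_bracket is_derivation_mult_left derivation_D derivation_D')+

lemma D'_nilpotent_Var: "i \<in> {1..n} \<Longrightarrow> (D' ^^ (n + 1 - i)) (Var (x i)) = 0"
proof (induction "n - i" arbitrary: i)
  case 0
  then show ?case by (auto simp: D'_Var)
next
  case (Suc k)
  have [simp]: "(D' ^^ j) (of_nat c * f) = of_nat c * (D' ^^ j) f" for j c f
    by (induction j) (auto simp: of_nat_mult_D')
  have "(D' ^^ (n + 1 - i)) (Var (x i)) = (D' ^^ (n + 1 - (i + 1))) (D' (Var (x i)))"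
    using Suc.prems by (simp add: Suc_diff_le flip: funpow_swap1)
  also have "\<dots> = 0"
    using Suc.prems Suc.hyps(1)[of "i + 1"] Suc.hyps(2) by (simp add: D'_Var del: of_nat_mult)
  finally show ?case .
qed

text \<open>Elements killed by some power of a derivation form a subalgebra, and each variable is
  such an element because \<open>D'\<close> pushes indices up to \<open>n\<close> and then to
  zero.\<close>

lemma D'_nilpotent: "\<exists>N. (D' ^^ N) f = 0"
proof (induction f rule: mpoly_ring_induct)
  case (Const c)
  show ?case by (rule exI[of _ 1]) (simp add: derivation_Const[OF derivation_D'])
next
  case (Var v)
  then show ?case by (metis Var_cases D'_nilpotent_Var)
next
  case (add f g)
  then obtain p q where pq: "(D' ^^ p) f = 0" "(D' ^^ q) g = 0" by blast
  have "(D' ^^ (q + p)) f = 0" "(D' ^^ (p + q)) g = 0"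
    unfolding funpow_add by (simp_all add: pq derivation_pow_zero[OF derivation_D'])
  then show ?case
    by (intro exI[of _ "p + q"]) (simp add: derivation_pow_add[OF derivation_D'] add.commute)
next
  case (mult f g)
  then show ?case by (blast intro: derivation_pow_mult_eq_0[OF derivation_D'])
qed

sublocale lowering_nilpotent_sl2_pair "\<lambda>c f. Const c * f" D D'
proof
  show "D (D' (D f)) - D' (D (D f)) = D (D (D' f) - D' (D f)) + Const 2 * D f" for f
    using lie_bracket_H_D[of f] by (simp add: lie_bracket_def two_eq_Const algebra_simps)
  show "D (D' (D' f)) - D' (D (D' f)) = D' (D (D' f) - D' (D f)) - Const 2 * D' f" for f
    using lie_bracket_H_D'[of f] by (simp add: lie_bracket_def two_eq_Const algebra_simps)
qed (simp_all add: derivation_add[OF derivation_D] derivation_add[OF derivation_D']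
    derivation_scale[OF derivation_D] derivation_scale[OF derivation_D'] D'_nilpotent
    Const_add Const_mult Const_1 distrib_left distrib_right mult.assoc)

lemma H_eq: "H = lie_bracket D D'"
  by (simp add: H_def lie_bracket_def fun_eq_iff)

lemma derivation_H: "is_derivation H"
  unfolding H_eq by (rule derivation_lie_bracket_D_D')

text \<open>Since \<open>H\<close> is a derivation, weights add under multiplication; constants have
  weight zero.\<close>

lemma monomial_weight: "\<exists>d. Poly_Mapping.single m c \<in> weight_space d"
proof (induction rule: monomial_induct)
  case Const
  have "Const 0 = (0 :: ('k, 'v) mpoly)"
    by (simp add: Const_def)
  then show ?case
    by (intro exI[of _ 0]) (simp add: weight_space_def derivation_Const[OF derivation_H])
next
  case (Var_mult v f)
  then obtain d where d: "H f = Const d * f" by (auto simp: weight_space_def)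
  obtain i where i: "i \<in> {1..n}" "v = x i" by (rule Var_cases)
  have "H (Var v * f) = Const (of_nat (n + 1) - of_nat (2 * i) + d) * (Var v * f)"
    unfolding derivation_mult[OF derivation_H] d
    unfolding H_eq i(2) lie_bracket_D_D'_Var[OF i(1)] Const_add Const_diff of_nat_eq_Const[symmetric]
    by (simp only: ring_distribs mult_ac)
  then show ?case by (auto simp: weight_space_def)
qed

lemma span_weight_spaces_UNIV: "f \<in> span (\<Union>d. weight_space d)"
proof (induction f rule: mpoly_induct)
  case (single m c)
  from monomial_weight[of m c] show ?case by (intro span_base) simp
qed (simp_all add: span_zero span_add)

section \<open>The centralizer and the kernel of \<open>D^n\<close>\<close>

lemma centralizer_iff: "T \<in> centralizer D \<longleftrightarrow> is_derivation T \<and> (\<forall>f. T (D f) = D (T f))"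
  by (auto simp: centralizer_def W_def lie_bracket_def fun_eq_iff)

lemma centralizer_subset_D_sub:
  assumes "T \<in> centralizer D"
  obtains s where "(D ^^ n) s = 0" "T = D_sub n x s"
proof -
  have T: "is_derivation T" and comm: "T (D f) = D (T f)" for f
    using assms by (simp_all add: centralizer_iff)
  let ?s = "T (Var (x n))"
  have down: "T (Var (x (n - k))) = (D ^^ k) ?s" if "k < n" for k
    using that
  proof (induction k)
    case (Suc k)
    then have "D (Var (x (n - k))) = Var (x (n - Suc k))"
      by (subst D_Var) auto
    then show ?case using comm[of "Var (x (n - k))"] Suc by simp
  qed simp
  \<comment> \<open>The condition on \<open>?s\<close> comes from the last variable reached, since
    \<open>D\<close> kills \<open>Var (x 1)\<close>.\<close>
  have "(D ^^ n) ?s = D ((D ^^ (n - 1)) ?s)"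
    using n_pos by (cases n) auto
  also have "\<dots> = T (D (Var (x 1)))"
    using down[of "n - 1"] n_pos comm[of "Var (x 1)"] by simp
  also have "\<dots> = 0"
    using n_pos D_Var[of 1] by (simp add: derivation_zero[OF T])
  finally have "(D ^^ n) ?s = 0" .
  moreover have "T f = D_sub n x ?s f" for f
  proof (rule derivation_eqI[OF T is_derivation_D_sub])
    fix v
    obtain i where i: "i \<in> {1..n}" "v = x i" by (rule Var_cases)
    then show "T (Var v) = D_sub n x ?s (Var v)"
      using down[of "n - i"] by (simp add: D_sub_Var)
  qed
  ultimately show ?thesis using that by blast
qed

text \<open>The bracket is a derivation, so the variables suffice. For \<open>i > 1\<close> both
  terms are \<open>D^(n-i+1) s\<close>; the hypothesis enters at \<open>i = 1\<close>.\<close>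

lemma D_sub_in_centralizer:
  assumes "(D ^^ n) s = 0"
  shows "D_sub n x s \<in> centralizer D"
proof -
  have Var: "lie_bracket (D_sub n x s) D (Var v) = 0" for v
  proof -
    obtain i where i: "i \<in> {1..n}" "v = x i" by (rule Var_cases)
    have step: "D ((D ^^ (n - i)) s) = (D ^^ Suc (n - i)) s"
      by simp
    show ?thesis
    proof (cases "i = 1")
      case True
      with n_pos have "Suc (n - i) = n" by simp
      with True i show ?thesis
        unfolding lie_bracket_def i(2) D_sub_Var[OF i(1)] step
        by (simp add: assms D_Var derivation_zero[OF is_derivation_D_sub])
    next
      case False
      with i(1) have "i - 1 \<in> {1..n}" "Suc (n - i) = n - (i - 1)" by auto
      with False i(1) show ?thesis
        unfolding lie_bracket_def i(2) D_sub_Var[OF i(1)] step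
        by (simp only: D_Var D_sub_Var if_False diff_self)
    qed
  qed
  have "lie_bracket (D_sub n x s) D f = 0" for f
    by (rule derivation_eq_0I[where T = "lie_bracket (D_sub n x s) D", OF _ Var])
      (intro is_derivation_lie_bracket is_derivation_D_sub derivation_D)
  then show ?thesis
    using is_derivation_D_sub by (auto simp: centralizer_def W_def)
qed

lemma is_submodule_centralizer: "is_submodule (Ker D) (centralizer D)"
  unfolding is_submodule_def
proof (intro conjI ballI)
  show "(\<lambda>f. 0) \<in> centralizer D"
    by (simp add: centralizer_iff is_derivation_zero derivation_zero[OF derivation_D])
next
  fix T U :: "('k, 'v) mpoly \<Rightarrow> ('k, 'v) mpoly"
  assume "T \<in> centralizer D" "U \<in> centralizer D"
  then show "(\<lambda>f. T f + U f) \<in> centralizer D"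
    by (simp add: centralizer_iff is_derivation_add derivation_add[OF derivation_D])
next
  fix c :: "('k, 'v) mpoly" and T
  assume "c \<in> Ker D" "T \<in> centralizer D"
  then show "(\<lambda>f. c * T f) \<in> centralizer D"
    by (simp add: centralizer_iff Ker_def is_derivation_mult_left derivation_mult[OF derivation_D])
qed

lemma D_sub_mult_kernel: "D c = 0 \<Longrightarrow> D_sub n x (c * s) = (\<lambda>f. c * D_sub n x s f)"
  by (simp add: D_sub_def derivation_pow_mult_kernel[OF derivation_D] sum_distrib_left
      mult.assoc fun_eq_iff)

end

subsection \<open>Products of iterated dual derivatives of generators\<close>

locale kernel_generators = ordered_variables n x K
  for n :: nat and x :: "nat \<Rightarrow> 'v::finite" and K :: "'k::field_char_0 itself" +
  fixes r :: nat and a :: "nat \<Rightarrow> ('k, 'v) mpoly"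
  assumes generators: "generated_subalgebra (a ` {1..r}) = Ker D"
begin

lemma D_generator: "i \<in> {1..r} \<Longrightarrow> D (a i) = 0"
  using generators hull_subset[of "a ` {1..r}" is_subalgebra]
  by (auto simp: generated_subalgebra_def Ker_def image_subset_iff)

text \<open>Products in \<open>S_set\<close> have at least one factor, so writing \<open>1\<close>
  as one of them takes an index. Without generators the kernel would consist of constants, but it
  contains \<open>Var (x 1)\<close>.\<close>

lemma r_pos: "r > 0"
proof (rule ccontr)
  assume "\<not> r > 0"
  then have "Ker D = is_subalgebra hull {}"
    using generators by (simp add: generated_subalgebra_def)
  also have "\<dots> \<subseteq> range Const"
    by (rule hull_minimal)
      (auto simp: is_subalgebra_def Const_1 simp flip: Const_add Const_mult intro: range_eqI[of _ _ 1])
  finally have "Var (x 1) \<in> range (Const :: 'k \<Rightarrow> ('k, 'v) mpoly)"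
    using n_pos D_Var[of 1] by (auto simp: Ker_def)
  then obtain c where "Var (x 1) = (Const c :: ('k, 'v) mpoly)" by blast
  then have "partial (x 1) (Var (x 1)) = partial (x 1) (Const c :: ('k, 'v) mpoly)" by simp
  then show False by (simp add: partial_Var partial_Const)
qed

text \<open>
  The products in \<open>S_set\<close> with bound \<open>w\<close> in place of \<open>n - 1\<close>, together with the empty product,
  and the \<open>Ker D\<close>-module they span.
\<close>

inductive products :: "nat \<Rightarrow> ('k, 'v) mpoly \<Rightarrow> bool" where
  one: "products w 1"
| step: "products w s \<Longrightarrow> i \<in> {1..r} \<Longrightarrow> products (k + w) (dual_power n x k (a i) * s)"

inductive_set product_module :: "nat \<Rightarrow> ('k, 'v) mpoly set" for w :: nat where
  zero: "0 \<in> product_module w"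
| add: "f \<in> product_module w \<Longrightarrow> g \<in> product_module w \<Longrightarrow> f + g \<in> product_module w"
| base: "c \<in> Ker D \<Longrightarrow> products w s \<Longrightarrow> c * s \<in> product_module w"

lemma products_mono: "products w s \<Longrightarrow> w \<le> w' \<Longrightarrow> products w' s"
proof (induction arbitrary: w' rule: products.induct)
  case (step w s i k)
  then have "products (k + (w' - k)) (dual_power n x k (a i) * s)"
    by (intro products.step) auto
  then show ?case using step.prems by simp
qed (rule products.one)

lemma products_mult: "products v s \<Longrightarrow> products w t \<Longrightarrow> products (v + w) (s * t)"
proof (induction rule: products.induct)
  case (one v)
  then show ?case using products_mono[of w t "v + w"] by simp
next
  case (step v s i k)
  then have "products (k + (v + w)) (dual_power n x k (a i) * (s * t))"
    by (intro products.step)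
  then show ?case by (simp add: mult.assoc add.assoc)
qed

lemma Ker_mult: "c \<in> Ker D \<Longrightarrow> d \<in> Ker D \<Longrightarrow> c * d \<in> Ker D"
  by (simp add: Ker_def derivation_mult[OF derivation_D])

lemma product_module_mult:
  assumes "f \<in> product_module v" "g \<in> product_module w"
  shows "f * g \<in> product_module (v + w)"
  using assms(1)
proof (induction rule: product_module.induct)
  case (base c s)
  show ?case
    using assms(2)
  proof (induction rule: product_module.induct)
    case (base d t)
    have "(c * d) * (s * t) \<in> product_module (v + w)"
      using base \<open>c \<in> Ker D\<close> \<open>products v s\<close>
      by (intro product_module.base Ker_mult products_mult)
    then show ?case by (simp add: mult_ac)
  qed (simp_all add: distrib_left product_module.intros)
qed (simp_all add: distrib_right product_module.intros)

lemma one_mem_Ker: "1 \<in> Ker D" and Const_mem_Ker: "Const c \<in> Ker D"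
  by (simp_all add: Ker_def derivation_one[OF derivation_D] derivation_Const[OF derivation_D])

lemma product_module_scale:
  assumes "f \<in> product_module w" "c \<in> Ker D"
  shows "c * f \<in> product_module w"
  using product_module_mult[OF product_module.base[OF assms(2) products.one[of 0]] assms(1)] by simp

text \<open>For \<open>k = 0\<close> the generator is not itself a product, as
  \<open>dual_power\<close> then gives \<open>1\<close>; it enters as a coefficient from
  \<open>Ker D\<close>.\<close>

lemma D'_pow_generator:
  assumes "i \<in> {1..r}"
  shows "(D' ^^ k) (a i) \<in> product_module k"
proof (cases "k = 0")
  case True
  then show ?thesis
    using product_module.base[of "a i" 0 1] products.one assms D_generator by (simp add: Ker_def)
next
  case False
  have "1 * (dual_power n x k (a i) * 1) \<in> product_module (k + 0)"
    using assms by (intro product_module.base one_mem_Ker products.intros)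
  with False show ?thesis by (simp add: dual_power_def)
qed

text \<open>The elements with this property for all \<open>k\<close> form a subalgebra, by the
  Leibniz rule with initial orders zero, and it contains the generators.\<close>

lemma D'_pow_kernel:
  assumes "h \<in> Ker D"
  shows "(D' ^^ k) h \<in> product_module k"
proof -
  let ?B = "{h. \<forall>k. (D' ^^ k) h \<in> product_module k}"
  have "is_subalgebra ?B"
    unfolding is_subalgebra_def
  proof (intro conjI ballI allI CollectI)
    fix k
    have "1 * 1 \<in> product_module k"
      by (intro product_module.base one_mem_Ker products.one)
    then show "(D' ^^ k) 1 \<in> product_module k"
      by (cases k) (simp_all add: funpow_Suc_right derivation_one[OF derivation_D']
          derivation_pow_zero[OF derivation_D'] product_module.zero del: funpow.simps(2))
  next
    fix f g k
    assume fg: "f \<in> ?B" "g \<in> ?B"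
    then show "(D' ^^ k) (f + g) \<in> product_module k"
      by (simp add: derivation_pow_add[OF derivation_D'] product_module.add)
    show "(D' ^^ k) (f * g) \<in> product_module k"
      using derivation_Leibniz_closed[OF derivation_D', of product_module f 0 g 0 k] fg
        product_module.add product_module_mult by simp
  next
    fix c f k
    assume "f \<in> ?B"
    then show "(D' ^^ k) (Const c * f) \<in> product_module k"
      by (simp add: derivation_pow_mult_kernel[OF derivation_D'] derivation_Const[OF derivation_D']
          product_module_scale Const_mem_Ker)
  qed
  moreover have "a ` {1..r} \<subseteq> ?B"
    using D'_pow_generator by auto
  ultimately have "is_subalgebra hull (a ` {1..r}) \<subseteq> ?B"
    by (rule hull_minimal[rotated])
  with assms show ?thesis
    unfolding generators[symmetric] generated_subalgebra_def by blast
qed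

section \<open>Comparison with \<open>S_set\<close> and the generation theorem\<close>

lemma products_eq_prod:
  assumes "products w s"
  shows "\<exists>(t::nat) i k. t \<ge> 1 \<and> (\<forall>j\<in>{1..t}. i j \<in> {1..r}) \<and> (\<Sum>j\<in>{1..t}. k j) \<le> w \<and>
    s = (\<Prod>j\<in>{1..t}. dual_power n x (k j) (a (i j)))"
  using assms
proof (induction rule: products.induct)
  case (one w)
  \<comment> \<open>The empty product is written as one factor of order \<open>0\<close>, which is
    \<open>1\<close> by convention.\<close>
  then show ?case
    using r_pos
    by (intro exI[of _ 1] exI[of _ "\<lambda>_. 1"] exI[of _ "\<lambda>_. 0"]) (simp add: dual_power_def)
next
  case (step w s i0 k0)
  then obtain t i k where ih: "t \<ge> (1::nat)" "\<forall>j\<in>{1..t}. i j \<in> {1..r}" "(\<Sum>j\<in>{1..t}. k j) \<le> w"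
    "s = (\<Prod>j\<in>{1..t}. dual_power n x (k j) (a (i j)))" by blast
  let ?i = "i(Suc t := i0)" and ?k = "k(Suc t := k0)"
  have "(\<Sum>j\<in>{1..t}. ?k j) = (\<Sum>j\<in>{1..t}. k j)"
    by (rule sum.cong) auto
  with ih(3) have "(\<Sum>j\<in>{1..Suc t}. ?k j) \<le> k0 + w"
    by simp
  moreover have "\<forall>j\<in>{1..Suc t}. ?i j \<in> {1..r}"
    using ih(2) step.hyps(2) by (auto simp: le_Suc_eq)
  moreover have "(\<Prod>j\<in>{1..Suc t}. dual_power n x (?k j) (a (?i j))) =
      dual_power n x k0 (a i0) * (\<Prod>j\<in>{1..t}. dual_power n x (?k j) (a (?i j)))"
    by (simp only: prod.cl_ivl_Suc fun_upd_same if_False mult.commute One_nat_def less_Suc0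
        nat.distinct)
  moreover have "(\<Prod>j\<in>{1..t}. dual_power n x (?k j) (a (?i j))) =
      (\<Prod>j\<in>{1..t}. dual_power n x (k j) (a (i j)))"
    by (rule prod.cong) simp_all
  ultimately show ?case
    unfolding ih(4) by (intro exI[of _ "Suc t"] exI[of _ ?i] exI[of _ ?k] conjI) simp_all
qed

lemma products_imp_S_set: "products (n - 1) s \<Longrightarrow> s \<in> S_set n x r a"
  using products_eq_prod unfolding S_set_def by blast

lemma D_pow_dual_power:
  assumes "i \<in> {1..r}"
  shows "(D ^^ Suc k) (dual_power n x k (a i)) = 0"
proof (cases "k = 0")
  case True
  then show ?thesis by (simp add: dual_power_def derivation_one[OF derivation_D])
next
  case False
  then show ?thesis
    using E_pow_F_pow_eq_0[OF D_generator[OF assms], of k] by (simp add: dual_power_def)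
qed

text \<open>A factor of order \<open>k\<close> is killed by \<open>D^(k+1)\<close>. In
  \<open>derivation_pow_mult_eq_0\<close> the exponents combine as \<open>p + q - 1\<close>, so a
  single extra \<open>1\<close> remains for the whole product.\<close>

lemma D_pow_prod_dual_power:
  assumes "\<forall>j\<in>{1..t::nat}. i j \<in> {1..r}"
  shows "(D ^^ Suc (\<Sum>j\<in>{1..t}. k j)) (\<Prod>j\<in>{1..t}. dual_power n x (k j) (a (i j))) = 0"
  using assms
proof (induction t)
  case 0
  then show ?case by (simp add: derivation_one[OF derivation_D])
next
  case (Suc t)
  from derivation_pow_mult_eq_0[OF derivation_D Suc.IH D_pow_dual_power[of "i (Suc t)" "k (Suc t)"]]
    Suc.prems
  show ?case by simp
qed

lemma D_pow_S_set:
  assumes "s \<in> S_set n x r a"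
  shows "(D ^^ n) s = 0"
proof -
  from assms obtain t i k where *: "\<forall>j\<in>{1..t::nat}. i j \<in> {1..r}" "(\<Sum>j\<in>{1..t}. k j) \<le> n - 1"
    and s: "s = (\<Prod>j\<in>{1..t}. dual_power n x (k j) (a (i j)))"
    unfolding S_set_def by blast
  let ?w = "Suc (\<Sum>j\<in>{1..t}. k j)"
  have "(D ^^ n) s = (D ^^ (n - ?w)) ((D ^^ ?w) s)"
    using *(2) n_pos by (subst comp_apply[symmetric], subst funpow_add[symmetric]) simp
  then show ?thesis
    unfolding s D_pow_prod_dual_power[OF *(1)] by (simp add: derivation_pow_zero[OF derivation_D])
qed

lemma kernel_D_pow_subset_product_module:
  assumes "(D ^^ n) s = 0"
  shows "s \<in> product_module (n - 1)"
  using kernel_E_pow[OF span_weight_spaces_UNIV assms]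
proof (induction rule: span_induct_alt)
  case base
  show ?case by (rule product_module.zero)
next
  case (step c f g)
  then obtain k h where f: "f = (D' ^^ k) h" "k < n" "D h = 0" by blast
  \<comment> \<open>Multiplying by \<open>1\<close>, taken with bound \<open>n - 1 - k\<close>,
    raises the bound from \<open>k\<close> to \<open>n - 1\<close>.\<close>
  have "f \<in> product_module (k + (n - 1 - k))"
    using product_module_mult[of f k 1 "n - 1 - k"] D'_pow_kernel[of h k] f
      product_module.base[OF one_mem_Ker products.one[of "n - 1 - k"]]
    by (simp add: Ker_def)
  with f(2) step(2) show ?case
    by (intro product_module.add product_module_scale Const_mem_Ker) simp_all
qed

text \<open>Both inclusions pass through the kernel of \<open>D^n\<close>, using that
  \<open>D_sub\<close> is additive and \<open>Ker D\<close>-linear in its polynomial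
  argument.\<close>

theorem centralizer_eq: "centralizer D = generated_submodule (Ker D) (D_sub n x ` S_set n x r a)"
proof
  show "generated_submodule (Ker D) (D_sub n x ` S_set n x r a) \<subseteq> centralizer D"
    unfolding generated_submodule_def
    by (rule hull_minimal)
      (use D_sub_in_centralizer D_pow_S_set is_submodule_centralizer in auto)
next
  let ?G = "generated_submodule (Ker D) (D_sub n x ` S_set n x r a)"
  have G: "is_submodule (Ker D) ?G"
    unfolding generated_submodule_def by (rule hull_in) (auto simp: is_submodule_def)
  have gen: "D_sub n x ` S_set n x r a \<subseteq> ?G"
    unfolding generated_submodule_def by (rule hull_subset)
  have "D_sub n x s \<in> ?G" if "s \<in> product_module (n - 1)" for s
    using that
  proof (induction rule: product_module.induct)
    case zero
    have "D_sub n x 0 = (\<lambda>f. 0 :: ('k, 'v) mpoly)"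
      by (simp add: D_sub_def derivation_pow_zero[OF derivation_D] fun_eq_iff)
    with G show ?case by (simp add: is_submodule_def)
  next
    case (add f g)
    with G show ?case by (simp add: D_sub_add is_submodule_def)
  next
    case (base c s)
    then have "D_sub n x s \<in> ?G" using gen products_imp_S_set by blast
    with G base(1) show ?case
      by (simp add: D_sub_mult_kernel Ker_def is_submodule_def)
  qed
  then show "centralizer D \<subseteq> ?G"
    using centralizer_subset_D_sub kernel_D_pow_subset_product_module by (metis subsetI)
qed

end

theorem theorem3:
  fixes n r :: nat
    and x :: "nat \<Rightarrow> 'v::finite"
    and a :: "nat \<Rightarrow> ('k::{alg_closed_field, field_char_0}, 'v) mpoly"
  assumes "bij_betw x {1..n} (UNIV :: 'v set)"
    and "generated_subalgebra (a ` {1..r}) = Ker (weitzenboeck n x)"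
  shows "centralizer (weitzenboeck n x) =
      generated_submodule (Ker (weitzenboeck n x)) (D_sub n x ` S_set n x r a)"
proof -
  interpret kernel_generators n x "TYPE('k)" r a
    by unfold_locales (fact assms)+
  show ?thesis by (rule centralizer_eq)
qed

end
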